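(* Let $d\geq 2$ be an integer, let $(F_n^{(d)})_{n\in\mathbb{Z}}$ be the $d$-generalized Fibonacci numbers, let $q=q_d$ be the unique number in $(0,1)$ with $q+q^2+\dots+q^d=1$, let $c_d=\frac{1}{\sum_{i=1}^d i q^i}$, and put $x_n=F_n^{(d)}-c_d q^{-(n-1)}$ for $n\in\mathbb{Z}$. Then $|x_n|<1/2$ for all $n\in\mathbb{Z}$; consequently, for every $n\in\mathbb{Z}$, $F_n^{(d)}$ is the unique integer with minimal distance to $c_d q^{-(n-1)}$.
   Context: For an integer $d\geq 2$, the $d$-generalized Fibonacci numbers $F_n^{(d)}$, $n\in\mathbb{Z}$, are defined by $F_n^{(d)}=0$ for all $n\leq 0$, $F_1^{(d)}=1$, and $F_n^{(d)}=\sum_{i=1}^d F_{n-i}^{(d)}$ for all $n\geq 2$. *)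

theory Defs
  imports Complex_Main
begin

function gfib :: "nat \<Rightarrow> int \<Rightarrow> int" where
  "gfib d n = (if n \<le> 0 then 0 else if n = 1 then 1
     else (\<Sum>i = 1..d. gfib d (n - int i)))"
  by pat_completeness auto
termination
  by (relation "measure (\<lambda>(d, n). nat n)") auto

declare gfib.simps [simp del]

definition is_q :: "nat \<Rightarrow> real \<Rightarrow> bool" where
  "is_q d q \<longleftrightarrow> q \<in> {0<..<1} \<and> (\<Sum>i = 1..d. q ^ i) = 1"

lemma is_q_ex1:
  assumes "d \<ge> 2"
  shows "\<exists>!q. is_q d q"
proof -
  let ?f = "\<lambda>x::real. \<Sum>i = 1..d. x ^ i"
  have mono: "?f x < ?f y" if "0 < x" "x < y" for x y :: real
    using that assms by (intro sum_strict_mono power_strict_mono) auto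
  have f0: "?f 0 = 0" by (intro sum.neutral) (auto simp: power_0_left)
  have f1: "?f 1 = real d" by simp
  have "continuous_on {0..1} ?f" by (intro continuous_intros)
  then obtain q where q: "0 \<le> q" "q \<le> 1" "?f q = 1"
    using IVT'[of ?f 0 1 1] f0 f1 assms by auto
  have "q \<noteq> 0" using q(3) f0 by auto
  moreover have "q \<noteq> 1" using q(3) f1 assms by auto
  ultimately have "is_q d q" using q by (simp add: is_q_def)
  moreover have "x = y" if "is_q d x" "is_q d y" for x y
    using that mono[of x y] mono[of y x] unfolding is_q_def
    by (cases x y rule: linorder_cases) auto
  ultimately show ?thesis by blast
qed

definition q_of :: "nat \<Rightarrow> real" where
  "q_of d = (THE q. is_q d q)"

definition c_of :: "nat \<Rightarrow> real" where
  "c_of d = 1 / (\<Sum>i = 1..d. real i * q_of d ^ i)"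

definition x_of :: "nat \<Rightarrow> int \<Rightarrow> real" where
  "x_of d n = real_of_int (gfib d n) - c_of d * q_of d powi (- (n - 1))"

end

theory Submission
  imports Defs
begin

text \<open>
  Write \<open>\<alpha> = 1/q\<close>. Dividing the characteristic polynomial \<open>X^d - X^(d-1) - \<dots> - 1\<close> by \<open>X - \<alpha>\<close>
  gives a polynomial with coefficients \<open>b_j = q + \<dots> + q^(d-j)\<close>, which decrease from \<open>1\<close> to \<open>q\<close>.
  Since \<open>x_n\<close> has no component along \<open>\<alpha>^n\<close>, it is annihilated by this quotient; multiplying
  by \<open>X - 1\<close>, as in the Enestrom-Kakeya theorem, gives for \<open>n \<ge> 2\<close>
  the relation \<open>x_n = q^d x_(n-1) + q^(d-1) x_(n-2) + \<dots> + q x_(n-d)\<close>.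
  The weights are positive with sum \<open>1\<close>, so the bound \<open>1/2\<close> propagates by convexity from the
  indices \<open>n \<le> 1\<close>, where it is checked directly.
\<close>

lemma gfib_nonpos: "n \<le> 0 \<Longrightarrow> gfib d n = 0"
  by (subst gfib.simps) simp

lemma gfib_1: "gfib d 1 = 1"
  by (subst gfib.simps) simp

lemma gfib_rec:
  assumes "n \<ge> 2"
  shows "gfib d n = (\<Sum>j<d. gfib d (n - int (Suc j)))"
proof -
  have "gfib d n = (\<Sum>i = 1..d. gfib d (n - int i))"
    using assms by (subst gfib.simps) simp
  also have "\<dots> = (\<Sum>j<d. gfib d (n - int (Suc j)))"
    by (rule sum.reindex_bij_witness[of _ Suc "\<lambda>i. i - 1"]) auto
  finally show ?thesis .
qed

lemma is_q_q_of: "d \<ge> 2 \<Longrightarrow> is_q d (q_of d)"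
  unfolding q_of_def by (rule theI') (rule is_q_ex1)

lemma sum_powers_Suc:
  fixes q :: real
  shows "(\<Sum>i = 1..Suc m. q ^ i) = q + q * (\<Sum>i = 1..m. q ^ i)"
proof (induction m)
  case (Suc m)
  have "(\<Sum>i = 1..Suc (Suc m). q ^ i) = (\<Sum>i = 1..Suc m. q ^ i) + q * q ^ Suc m"
    by simp
  also have "\<dots> = q + q * ((\<Sum>i = 1..m. q ^ i) + q ^ Suc m)"
    unfolding Suc.IH by (simp add: distrib_left)
  finally show ?case by simp
qed simp

lemma sum_index_times_power:
  fixes q :: real
  shows "(1 - q) * (\<Sum>i = 1..m. real i * q ^ i) = (\<Sum>i = 1..m. q ^ i) - real m * q ^ Suc m"
proof (induction m)
  case (Suc m)
  have split: "(1 - q) * (\<Sum>i = 1..Suc m. real i * q ^ i)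
      = (1 - q) * (\<Sum>i = 1..m. real i * q ^ i) + (1 - q) * (real (Suc m) * q ^ Suc m)"
    by (simp add: distrib_left)
  show ?case unfolding split Suc.IH by (simp add: algebra_simps)
qed simp

locale fib_root =
  fixes d :: nat and q :: real
  assumes d_ge_2: "d \<ge> 2" and is_q: "is_q d q"
begin

lemma q_pos: "q > 0" and q_less_1: "q < 1" and sum_q: "(\<Sum>i = 1..d. q ^ i) = 1"
  using is_q by (auto simp: is_q_def)

lemma power_Suc_d: "q ^ Suc d = 2 * q - 1"
  using sum_powers_Suc[of q d] sum_q by simp

lemma weights_sum: "(\<Sum>j<d. q ^ (d - j)) = 1"
proof -
  have "(\<Sum>j<d. q ^ (d - j)) = (\<Sum>i = 1..d. q ^ i)"
    by (rule sum.reindex_bij_witness[of _ "\<lambda>i. d - i" "\<lambda>j. d - j"]) auto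
  then show ?thesis using sum_q by simp
qed

text \<open>The reciprocal of \<open>c_of d\<close> when \<open>q = q_of d\<close>; also
  \<open>q\<close> times the derivative of X + ... + X^d at \<open>q\<close>.\<close>

definition S :: real where
  "S = (\<Sum>i = 1..d. real i * q ^ i)"

lemma S_times: "(1 - q) * S = 1 - real d * q ^ Suc d"
  unfolding S_def sum_index_times_power sum_q ..

text \<open>After multiplication by \<open>1 - q\<close>, this says that
  \<open>q ^ Suc d = 2 * q - 1\<close>, being positive, is less than \<open>d\<close> times
  itself.\<close>

lemma S_less_2: "S < 2"
proof -
  have "q ^ Suc d > 0" using q_pos by simp
  then have "2 * q - 1 > 0" using power_Suc_d by simp
  then have "1 * (2 * q - 1) < real d * (2 * q - 1)"
    using d_ge_2 by (intro mult_strict_right_mono) auto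
  then have "(1 - q) * S < (1 - q) * 2"
    unfolding S_times power_Suc_d by (simp add: algebra_simps)
  then show ?thesis using q_less_1 by (simp only: mult_less_cancel_left_pos diff_gt_0_iff_gt)
qed

text \<open>Subtracting the root equation leaves the weights \<open>i - 1\<close>; the term
  \<open>i = 2\<close> alone is the square of \<open>q\<close>.\<close>

lemma S_ge: "S \<ge> 1 + q\<^sup>2"
proof -
  have "q\<^sup>2 = real (2 - 1) * q ^ 2" by simp
  also have "\<dots> \<le> (\<Sum>i = 1..d. real (i - 1) * q ^ i)"
    using d_ge_2 q_pos by (intro member_le_sum) auto
  also have "\<dots> = (\<Sum>i = 1..d. real i * q ^ i - q ^ i)"
    by (intro sum.cong) (auto simp: algebra_simps of_nat_diff)
  also have "\<dots> = S - 1" unfolding S_def sum_subtractf sum_q ..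
  finally show ?thesis by simp
qed

lemma S_greater: "2 * q < S"
proof -
  have "(1 - q)\<^sup>2 > 0" using q_less_1 by simp
  then show ?thesis using S_ge by (simp add: power2_eq_square algebra_simps)
qed

definition b :: "nat \<Rightarrow> real" where
  "b j = (\<Sum>i = 1..d - j. q ^ i)"

lemma b_0: "b 0 = 1" and b_d: "b d = 0"
  using sum_q by (simp_all add: b_def)

text \<open>Peeling off the lowest power expresses division by X - \<alpha>; peeling off the highest
  exhibits the convex weights as differences of consecutive \<open>b j\<close>.\<close>

lemma b_step:
  assumes "j < d"
  shows "b j = q + q * b (Suc j)" and "b j = b (Suc j) + q ^ (d - j)"
proof -
  have *: "d - j = Suc (d - Suc j)" using assms by simp
  show "b j = q + q * b (Suc j)" unfolding b_def * by (rule sum_powers_Suc)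
  show "b j = b (Suc j) + q ^ (d - j)" unfolding b_def * by simp
qed

text \<open>The quotient polynomial applied to the Fibonacci sequence; only the \<alpha>^n component
  survives, so \<open>G\<close> is geometric from index 1 on.\<close>

definition G :: "int \<Rightarrow> real" where
  "G n = (\<Sum>j<d. b j * real_of_int (gfib d (n - int j)))"

lemma G_shift:
  "G n = real_of_int (gfib d n) + (\<Sum>j<d. b (Suc j) * real_of_int (gfib d (n - int (Suc j))))"
proof -
  \<comment> \<open>The extra term \<open>j = d\<close> vanishes because
    \<open>b d = 0\<close>.\<close>
  have "G n = (\<Sum>j<Suc d. b j * real_of_int (gfib d (n - int j)))"
    by (simp add: G_def b_d)
  also have "\<dots> = real_of_int (gfib d n)
      + (\<Sum>j<d. b (Suc j) * real_of_int (gfib d (n - int (Suc j))))"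
    by (subst sum.lessThan_Suc_shift) (simp add: b_0)
  finally show ?thesis .
qed

lemma G_pred: "G (n - 1) = (\<Sum>j<d. b j * real_of_int (gfib d (n - int (Suc j))))"
  by (simp add: G_def algebra_simps)

lemma G_1: "G 1 = 1"
  by (subst G_shift) (simp add: gfib_nonpos gfib_1)

text \<open>With \<open>b j = q + q * b (Suc j)\<close>, the constant parts sum to
  \<open>q * gfib d n\<close> by the recurrence, hence \<open>n \<ge> 2\<close>, and the rest is
  \<open>q\<close> times the tail in \<open>G_shift\<close>.\<close>

lemma G_rec:
  assumes "n \<ge> 2"
  shows "G (n - 1) = q * G n"
proof -
  let ?F = "\<lambda>j. real_of_int (gfib d (n - int (Suc j)))"
  have "G (n - 1) = (\<Sum>j<d. q * ?F j + q * (b (Suc j) * ?F j))"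
    unfolding G_pred by (intro sum.cong) (auto simp: b_step(1) algebra_simps)
  also have "\<dots> = q * ((\<Sum>j<d. ?F j) + (\<Sum>j<d. b (Suc j) * ?F j))"
    by (simp add: sum.distrib sum_distrib_left distrib_left)
  also have "(\<Sum>j<d. ?F j) = real_of_int (gfib d n)"
    using gfib_rec[OF assms, of d] by simp
  finally show ?thesis unfolding G_shift .
qed

lemma G_eq:
  assumes "n \<ge> 1"
  shows "G n = q powi (1 - n)"
  using assms
proof (induction n rule: int_ge_induct)
  case base
  then show ?case by (simp add: G_1)
next
  case (step n)
  have "q * G (n + 1) = q powi (1 - n)"
    using G_rec[of "n + 1"] step by simp
  also have "\<dots> = q * q powi (1 - (n + 1))"
    using q_pos power_int_add_1'[of q "1 - (n + 1)"] by simp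
  finally show ?case using q_pos by simp
qed

text \<open>Both sides come from evaluating \<open>G n - G (n - 1)\<close>: termwise by differences
  of \<open>b\<close>, and in closed form by \<open>G_eq\<close>.\<close>

lemma gfib_convex:
  assumes "n \<ge> 2"
  shows "real_of_int (gfib d n) =
    (\<Sum>j<d. q ^ (d - j) * real_of_int (gfib d (n - int (Suc j)))) + (1 - q) * q powi (1 - n)"
proof -
  let ?F = "\<lambda>j. real_of_int (gfib d (n - int (Suc j)))"
  have "G (n - 1) = (\<Sum>j<d. b (Suc j) * ?F j + q ^ (d - j) * ?F j)"
    unfolding G_pred by (intro sum.cong) (auto simp: b_step(2) distrib_right)
  then have "G (n - 1) = (G n - real_of_int (gfib d n)) + (\<Sum>j<d. q ^ (d - j) * ?F j)"
    by (simp add: G_shift[of n] sum.distrib)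
  then show ?thesis
    using G_rec[OF assms] G_eq[of n] assms by (simp add: algebra_simps)
qed

definition x :: "int \<Rightarrow> real" where
  "x n = real_of_int (gfib d n) - q powi (1 - n) / S"

lemma x_convex:
  assumes "n \<ge> 2"
  shows "x n = (\<Sum>j<d. q ^ (d - j) * x (n - int (Suc j)))"
proof -
  \<comment> \<open>Weight and geometric term combine to a value independent of \<open>j\<close>, so
    the sum is \<open>d\<close> equal terms. By \<open>S_times\<close> their total absorbs exactly
    the inhomogeneous term of \<open>gfib_convex\<close>.\<close>
  have "q ^ (d - j) * q powi (1 - (n - int (Suc j))) = q ^ Suc d * q powi (1 - n)"
    if "j < d" for j
  proof -
    have "q powi (1 - (n - int (Suc j))) = q ^ Suc j * q powi (1 - n)"
      using q_pos power_int_add[of q "int (Suc j)" "1 - n"]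
      by (simp only: power_int_of_nat) (simp add: algebra_simps)
    moreover have "q ^ (d - j) * q ^ Suc j = q ^ Suc d"
      using that by (simp flip: power_add del: power_Suc)
    ultimately show ?thesis by (metis mult.assoc)
  qed
  then have "(\<Sum>j<d. q ^ (d - j) * (q powi (1 - (n - int (Suc j))) / S))
      = (\<Sum>j<d. q ^ Suc d * q powi (1 - n) / S)"
    by (intro sum.cong) (simp_all only: times_divide_eq_right lessThan_iff)
  also have "\<dots> = (1 - (1 - q) * S) * q powi (1 - n) / S"
    by (simp add: S_times)
  also have "\<dots> = q powi (1 - n) / S - (1 - q) * q powi (1 - n)"
    using S_greater q_pos by (simp add: field_simps)
  finally show ?thesis
    unfolding x_def gfib_convex[OF assms] right_diff_distrib sum_subtractf by simp
qed

text \<open>Only the geometric term remains, and it is at most \<open>q / S\<close>, which is below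
  1/2 by \<open>S_greater\<close>.\<close>

lemma abs_x_nonpos:
  assumes "n \<le> 0"
  shows "\<bar>x n\<bar> < 1 / 2"
proof -
  have "q powi (1 - n) = q ^ nat (1 - n)"
    using assms by (simp add: power_int_def)
  also have "\<dots> \<le> q ^ 1"
    using assms q_pos q_less_1 by (intro power_decreasing) auto
  finally have "q powi (1 - n) < S / 2" using S_greater by simp
  moreover have "q powi (1 - n) > 0" using q_pos by simp
  ultimately show ?thesis
    using S_greater q_pos by (simp add: x_def gfib_nonpos[OF assms] field_simps)
qed

lemma abs_x_1: "\<bar>x 1\<bar> < 1 / 2"
proof -
  have "S \<ge> 1" using S_ge zero_le_power2[of q] by linarith
  then have "1 / S \<le> 1" and "1 / S > 1 / 2"
    using S_less_2 by (simp_all add: field_simps)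
  then show ?thesis by (simp add: x_def gfib_1)
qed

lemma abs_x_less: "\<bar>x n\<bar> < 1 / 2"
proof (induction "nat n" arbitrary: n rule: less_induct)
  case less
  consider "n \<le> 0" | "n = 1" | "n \<ge> 2" by linarith
  then show ?case
  proof cases
    case 3
    have "\<bar>x n\<bar> \<le> (\<Sum>j<d. \<bar>q ^ (d - j) * x (n - int (Suc j))\<bar>)"
      unfolding x_convex[OF 3] by (rule sum_abs)
    also have "\<dots> < (\<Sum>j<d. q ^ (d - j) * (1 / 2))"
    proof (rule sum_strict_mono)
      fix j assume "j \<in> {..<d}"
      \<comment> \<open>The index may be nonpositive; \<open>nat\<close> then sends it to 0, still
        below \<open>nat n\<close>.\<close>
      have "\<bar>x (n - int (Suc j))\<bar> < 1 / 2" using 3 by (intro less) simp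
      then show "\<bar>q ^ (d - j) * x (n - int (Suc j))\<bar> < q ^ (d - j) * (1 / 2)"
        unfolding abs_mult using q_pos by simp
    qed (use d_ge_2 in \<open>auto simp: lessThan_empty_iff\<close>)
    also have "\<dots> = 1 / 2"
      using weights_sum by (simp flip: sum_distrib_right sum_divide_distrib)
    finally show ?thesis .
  qed (use abs_x_nonpos abs_x_1 in blast)+
qed

end

lemma abs_x_of_less:
  assumes "d \<ge> 2"
  shows "\<bar>x_of d n\<bar> < 1 / 2"
proof -
  interpret fib_root d "q_of d"
    using assms is_q_q_of by unfold_locales auto
  have "x_of d n = x n"
    by (simp add: x_of_def x_def c_of_def S_def)
  then show ?thesis using abs_x_less by simp
qed

text \<open>Any other integer is at least 1 away from \<open>f\<close>, hence more than 1/2 away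
  from \<open>a\<close>.\<close>

lemma is_arg_min_dist_int_iff:
  fixes a :: real and f m :: int
  assumes "\<bar>real_of_int f - a\<bar> < 1 / 2"
  shows "is_arg_min (\<lambda>k::int. \<bar>real_of_int k - a\<bar>) (\<lambda>_. True) m \<longleftrightarrow> m = f"
proof -
  have far: "\<bar>real_of_int k - a\<bar> > 1 / 2" if "k \<noteq> f" for k
  proof -
    have "\<bar>real_of_int k - real_of_int f\<bar> \<ge> 1" using that by linarith
    then show ?thesis using assms by linarith
  qed
  show ?thesis
  proof
    assume "is_arg_min (\<lambda>k::int. \<bar>real_of_int k - a\<bar>) (\<lambda>_. True) m"
    then show "m = f"
      using far[of m] assms unfolding is_arg_min_def by (meson less_trans)
  next
    assume "m = f"
    then show "is_arg_min (\<lambda>k::int. \<bar>real_of_int k - a\<bar>) (\<lambda>_. True) m"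
      using far assms unfolding is_arg_min_def by (metis less_asym less_trans)
  qed
qed

theorem corollary3p3:
  fixes d :: nat
  assumes "d \<ge> 2"
  shows "(\<forall>n::int. \<bar>x_of d n\<bar> < 1 / 2) \<and>
    (\<forall>(n::int) (m::int).
       is_arg_min (\<lambda>k::int. \<bar>real_of_int k - c_of d * q_of d powi (- (n - 1))\<bar>) (\<lambda>_. True) m
       \<longleftrightarrow> m = gfib d n)"
  using abs_x_of_less[OF assms] is_arg_min_dist_int_iff[OF abs_x_of_less[OF assms, unfolded x_of_def]]
  by blast

end
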